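(* There exists $K\in\mathbb{N}$ such that for every multiple $k$ of $3$ with $k\geq K$ the following holds: for every orientation $D$ of the tree $T_k$, $W(D)\leq W(D_k)$, with equality if and only if $D$ equals $D_k$ or the converse of $D_k$. (In particular, for such $k$, every orientation of $T_k$ of maximum Wiener index contains a path whose edges change direction at least twice as the path is traversed, i.e. there is no vertex $v$ such that for every vertex $u$ there is a $(u,v)$-path or a $(v,u)$-path.)
   Context: For a digraph $D$ with vertex set $V$, $d_D(u,v)$ is the length of a shortest directed $(u,v)$-path if one exists and $0$ otherwise, and the Wiener index is $W(D)=\sum_{(u,v)\in V\times V} d_D(u,v)$. The converse of a digraph is obtained by reversing every arc. For $k$ a multiple of $3$, $T_k$ is the tree obtained from a path $w_1,w_2,\ldots,w_k$ by attaching $k^2/9$ new leaves $u_1,\ldots,u_{k^2/9}$ to $w_1$, attaching a path $x_1,x_2,x_3,x_4,x_5$ to $w_2$ (edge $w_2x_1$ and edges $x_ix_{i+1}$), and attaching one new leaf $y_1$ to $w_3$. $D_k$ is the orientation of $T_k$ with arcs $\overrightarrow{w_iw_{i+1}}$ for $1\le i\le k-1$, $\overrightarrow{u_jw_1}$ for all $j$, $\overrightarrow{w_2x_1}$ and $\overrightarrow{x_ix_{i+1}}$ for $1\le i\le 4$, and $\overrightarrow{y_1w_3}$. *)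

theory Defs
  imports "Graph_Theory.Pair_Digraph"
begin

definition distance :: "('a, 'b) pre_digraph \<Rightarrow> 'a \<Rightarrow> 'a \<Rightarrow> nat" where
  "distance G u v =
    (if \<exists>p. pre_digraph.apath G u p v
     then (LEAST n. \<exists>p. pre_digraph.apath G u p v \<and> length p = n)
     else 0)"

definition wiener_index :: "('a, 'b) pre_digraph \<Rightarrow> nat" where
  "wiener_index G = (\<Sum>(u, v) \<in> verts G \<times> verts G. distance G u v)"

definition converse_digraph :: "'a pair_pre_digraph \<Rightarrow> 'a pair_pre_digraph" where
  "converse_digraph D = \<lparr> pverts = pverts D, parcs = (parcs D)\<inverse> \<rparr>"

text \<open>An undirected graph is represented by its symmetric digraph: an edge between \<open>u\<close> and \<open>v\<close>
  is the pair of arcs \<open>(u, v)\<close> and \<open>(v, u)\<close>. An orientation keeps exactly one of the two.\<close>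

definition orientation_of :: "'a pair_pre_digraph \<Rightarrow> 'a pair_pre_digraph \<Rightarrow> bool" where
  "orientation_of D G \<longleftrightarrow>
    pverts D = pverts G \<and> parcs D \<subseteq> parcs G \<and>
    (\<forall>(u, v) \<in> parcs G. ((u, v) \<in> parcs D) \<noteq> ((v, u) \<in> parcs D))"

definition max_wiener_orientation :: "'a pair_pre_digraph \<Rightarrow> 'a pair_pre_digraph \<Rightarrow> bool" where
  "max_wiener_orientation D G \<longleftrightarrow>
    orientation_of D G \<and>
    (\<forall>D'. orientation_of D' G \<longrightarrow> wiener_index (with_proj D') \<le> wiener_index (with_proj D))"

text \<open>The number of direction changes of a path \<open>p\<close> of the underlying undirected graph with respect
  to the orientation \<open>D\<close>. The step \<open>p ! i\<close>, given as an ordered pair in the sense of traversal,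
  goes along its edge's orientation iff it is an arc of \<open>D\<close>, and against it otherwise.\<close>

definition direction_changes :: "'a pair_pre_digraph \<Rightarrow> ('a \<times> 'a) list \<Rightarrow> nat" where
  "direction_changes D p =
    card {i. Suc i < length p \<and> (p ! i \<in> parcs D) \<noteq> (p ! Suc i \<in> parcs D)}"

text \<open>\<open>Vw i\<close>, \<open>Vu j\<close>, \<open>Vx i\<close>, \<open>Vy\<close> are the vertices \<open>w\<^sub>i\<close>, \<open>u\<^sub>j\<close>, \<open>x\<^sub>i\<close>, \<open>y\<^sub>1\<close>;
  all indices start at 1.\<close>

datatype vertex = Vw nat | Vu nat | Vx nat | Vy

text \<open>The following two families are meaningful only if \<open>3 dvd k\<close> and \<open>k > 0\<close>; in particular
  \<open>k\<^sup>2 div 9\<close> is then an exact quotient.\<close>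

definition tree_verts :: "nat \<Rightarrow> vertex set" where
  "tree_verts k = Vw ` {1..k} \<union> Vu ` {1..k\<^sup>2 div 9} \<union> Vx ` {1..5} \<union> {Vy}"

definition tree_edges :: "nat \<Rightarrow> vertex rel" where
  "tree_edges k =
     {(Vw i, Vw (i + 1)) | i. 1 \<le> i \<and> i < k} \<union>
     {(Vw 1, Vu j) | j. 1 \<le> j \<and> j \<le> k\<^sup>2 div 9} \<union>
     {(Vw 2, Vx 1)} \<union> {(Vx i, Vx (i + 1)) | i. 1 \<le> i \<and> i \<le> 4} \<union>
     {(Vw 3, Vy)}"

definition tree :: "nat \<Rightarrow> vertex pair_pre_digraph" where
  "tree k = \<lparr> pverts = tree_verts k, parcs = tree_edges k \<union> (tree_edges k)\<inverse> \<rparr>"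

definition opt_orientation :: "nat \<Rightarrow> vertex pair_pre_digraph" where
  "opt_orientation k = \<lparr> pverts = tree_verts k, parcs =
     {(Vw i, Vw (i + 1)) | i. 1 \<le> i \<and> i \<le> k - 1} \<union>
     {(Vu j, Vw 1) | j. 1 \<le> j \<and> j \<le> k\<^sup>2 div 9} \<union>
     {(Vw 2, Vx 1)} \<union> {(Vx i, Vx (i + 1)) | i. 1 \<le> i \<and> i \<le> 4} \<union>
     {(Vy, Vw 3)} \<rparr>"

lemma orientation_of_opt_orientation: "orientation_of (opt_orientation k) (tree k)"
  unfolding orientation_of_def opt_orientation_def tree_def tree_edges_def by auto

lemma orientation_of_converse_digraph:
  "orientation_of (converse_digraph D) G" if "orientation_of D G" "sym (parcs G)"
  using that unfolding orientation_of_def converse_digraph_def by (auto dest: symD)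

end

theory Submission
  imports Defs
begin

text \<open>
  In an orientation of a tree, \<open>v\<close> is reachable from \<open>u\<close> iff all edges of the tree path between
  them point towards \<open>v\<close>, and then the distance is the tree distance. Up to taking the converse,
  \<open>w\<^sub>1 \<rightarrow> w\<^sub>2\<close>. If \<open>a\<close> leaves point to \<open>w\<^sub>1\<close> and \<open>b\<close> away from it, the pairs of leaves contribute
  \<open>2 a b\<close>, which with \<open>k\<^sup>2/9\<close> leaves is always outweighed by the loss of about \<open>b k\<^sup>2/2\<close> on the path
  \<open>w\<^sub>1, \<dots>, w\<^sub>k\<close>. A wrong edge on that path costs at least \<open>k * k\<^sup>2/9\<close>, and all pairs involving
  some \<open>x\<^sub>i\<close> or \<open>y\<^sub>1\<close> together are only of order \<open>k\<^sup>2\<close>. If the whole path is directed forward, the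
  branches decide in the order \<open>k\<^sup>2\<close>: the \<open>x\<close>-path gives \<open>25 k\<^sup>2/9\<close> outwards against about
  \<open>5 k\<^sup>2/2\<close> inwards, while \<open>y\<^sub>1\<close> gives about \<open>k\<^sup>2/2\<close> inwards against \<open>4 k\<^sup>2/9\<close> outwards.
\<close>

section \<open>Distances in oriented trees\<close>

lemma relpow_of_awalk:
  assumes "pre_digraph.awalk (with_proj D) u p v"
  shows "(u, v) \<in> parcs D ^^ length p"
proof -
  have "set p \<subseteq> parcs D" "pcas u p v"
    using assms by (auto simp: pre_digraph.awalk_def cas_with_proj_eq)
  then show ?thesis
  proof (induction p arbitrary: u)
    case (Cons e es)
    then have "(u, snd e) \<in> parcs D" "(snd e, v) \<in> parcs D ^^ length es"
      by (cases e, auto)+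
    then show ?case by (metis relpow_Suc_I2 length_Cons)
  qed simp
qed

lemma awalk_of_relpow:
  assumes "(u, v) \<in> parcs D ^^ n" "u \<in> pverts D"
  shows "\<exists>p. pre_digraph.awalk (with_proj D) u p v \<and> length p = n"
proof -
  have "\<exists>p. set p \<subseteq> parcs D \<and> pcas u p v \<and> length p = n"
    using assms(1)
  proof (induction n arbitrary: u)
    case (Suc n)
    then obtain s where s: "(u, s) \<in> parcs D" "(s, v) \<in> parcs D ^^ n"
      by (meson relpow_Suc_D2)
    from Suc.IH[OF s(2)] obtain p where "set p \<subseteq> parcs D" "pcas s p v" "length p = n" by blast
    with s(1) have "set ((u, s) # p) \<subseteq> parcs D" "pcas u ((u, s) # p) v" "length ((u, s) # p) = Suc n"
      by auto
    then show ?case by blast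
  qed (auto intro: exI[of _ "[]"])
  then show ?thesis
    using assms(2) by (auto simp: pre_digraph.awalk_def cas_with_proj_eq)
qed

text \<open>Two local properties express what is needed of acyclicity: neighbours differ by exactly
  one in their distance from \<open>p\<close>, and at most one neighbour of \<open>q\<close> is
  nearer to \<open>p\<close>.\<close>

locale tree_metric =
  fixes E :: "'a rel" and td :: "'a \<Rightarrow> 'a \<Rightarrow> nat"
  assumes td_self [simp]: "td p p = 0"
    and td_sym: "td p q = td q p"
    and td_edge: "(r, s) \<in> E \<Longrightarrow> td p s = Suc (td p r) \<or> td p r = Suc (td p s)"
    and td_pred_unique: "\<lbrakk>(r, q) \<in> E; (s, q) \<in> E; td p q = Suc (td p r); td p q = Suc (td p s)\<rbrakk>
      \<Longrightarrow> r = s"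

locale oriented_tree = tree_metric E td for E :: "'a rel" and td +
  fixes A :: "'a rel"
  assumes subE: "A \<subseteq> E" and symE: "sym E" and anti: "(u, v) \<in> A \<Longrightarrow> (v, u) \<notin> A"
begin

lemma td_le_relpow: "(p, q) \<in> A ^^ n \<Longrightarrow> td p q \<le> n"
proof (induction n arbitrary: q)
  case (Suc n)
  then obtain r where r: "(p, r) \<in> A ^^ n" "(r, q) \<in> A" by auto
  with Suc.IH have "td p r \<le> n" by blast
  moreover have "td p q \<le> Suc (td p r)" using td_edge[OF subsetD[OF subE r(2)], of p] by auto
  ultimately show ?case by simp
qed simp

text \<open>A directed walk from \<open>p\<close> never turns back: the only neighbour of
  \<open>r\<close> nearer to \<open>p\<close> is the vertex \<open>r'\<close> preceding it, and
  stepping there would use one edge in both directions.\<close>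

lemma relpow_td: "(p, q) \<in> A\<^sup>* \<Longrightarrow> (p, q) \<in> A ^^ td p q"
proof (induction rule: rtrancl_induct)
  case (step r s)
  have rs: "(r, s) \<in> E" "(s, r) \<in> E" using step(2) subE symE by (auto dest: symD)
  from td_edge[OF rs(1)] consider "td p s = Suc (td p r)" | "td p r = Suc (td p s)" by blast
  then show ?case
  proof cases
    case 1
    then show ?thesis using step by auto
  next
    case 2
    with step.IH obtain r' where r': "(p, r') \<in> A ^^ td p s" "(r', r) \<in> A" by auto
    with subE have r'E: "(r', r) \<in> E" by auto
    from td_le_relpow[OF r'(1)] 2 td_edge[OF r'E, of p] have "td p r = Suc (td p r')" by auto
    with td_pred_unique[OF r'E rs(2)] 2 have "r' = s" by blast
    with r'(2) step(2) anti show ?thesis by blast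
  qed
qed simp

text \<open>The last arc of a shortest walk from \<open>p\<close> to \<open>q\<close> and the first
  arc of a shortest walk back would both use the unique edge at \<open>q\<close> leading towards
  \<open>p\<close>, in opposite directions.\<close>

lemma reach_antisym:
  assumes "(p, q) \<in> A\<^sup>*" "(q, p) \<in> A\<^sup>*"
  shows "p = q"
proof (rule ccontr)
  assume "p \<noteq> q"
  have pq: "(p, q) \<in> A ^^ td p q" and qp: "(q, p) \<in> A ^^ td p q"
    using relpow_td[OF assms(1)] relpow_td[OF assms(2)] td_sym by auto
  with \<open>p \<noteq> q\<close> obtain n where n: "td p q = Suc n" by (cases "td p q") auto
  obtain r where r: "(p, r) \<in> A ^^ n" "(r, q) \<in> A" using pq n by auto
  obtain s where s: "(q, s) \<in> A" "(s, p) \<in> A ^^ n" using qp unfolding n by (meson relpow_Suc_D2)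
  have E: "(r, q) \<in> E" "(s, q) \<in> E" using r s subE symE by (auto dest: symD)
  have "td p r = n" "td p s = n"
    using td_le_relpow[OF r(1)] td_le_relpow[OF s(2)] td_edge[OF E(1), of p] td_edge[OF E(2), of p] n
      td_sym[of s p] by auto
  then have "r = s" using td_pred_unique[OF E, of p] n by simp
  with r s anti show False by blast
qed

end

lemma distance_oriented_tree:
  assumes "oriented_tree E td (parcs D)" "parcs D \<subseteq> pverts D \<times> pverts D" "u \<in> pverts D"
  shows "distance (with_proj D) u v = (if (u, v) \<in> (parcs D)\<^sup>* then td u v else 0)"
proof -
  interpret oriented_tree E td "parcs D" by fact
  interpret pair_wf_digraph D using assms(2) by unfold_locales auto
  show ?thesis
  proof (cases "(u, v) \<in> (parcs D)\<^sup>*")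
    case True
    obtain p where p: "awalk u p v" "length p = td u v"
      using awalk_of_relpow[OF relpow_td[OF True] assms(3)] by blast
    have ap: "apath u (awalk_to_apath p) v" by (rule apath_awalk_to_apath[OF p(1)])
    have ge: "td u v \<le> length q" if "apath u q v" for q
      by (rule td_le_relpow[OF relpow_of_awalk[OF awalkI_apath[OF that]]])
    \<comment> \<open>The arcs of the extracted path are distinct and all occur in \<open>p\<close>,
      so it is no longer than \<open>p\<close>.\<close>
    have "distinct (awalk_to_apath p)"
      using ap distinct_verts_imp_distinct by (auto simp: apath_def)
    then have "length (awalk_to_apath p) \<le> length p"
      using awalk_to_apath_subset[OF p(1)]
      by (metis card_length card_mono distinct_card finite_set order_trans)
    with ge[OF ap] p(2) have "length (awalk_to_apath p) = td u v" by simp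
    with ap ge have "(LEAST n. \<exists>p. apath u p v \<and> length p = n) = td u v"
      by (intro Least_equality) blast+
    then show ?thesis using ap True unfolding distance_def by auto
  next
    case False
    then have "\<nexists>p. apath u p v"
      using relpow_imp_rtrancl[OF relpow_of_awalk[OF awalkI_apath]] by metis
    then show ?thesis using False unfolding distance_def by simp
  qed
qed

text \<open>Applied below to sets \<open>S\<close> joined to their complement by a single tree edge,
  whose orientation then decides whether \<open>S\<close> can be left.\<close>

lemma cut:
  assumes "(p, q) \<in> A\<^sup>*" "p \<in> S" "q \<notin> S"
  shows "\<exists>r s. (r, s) \<in> A \<and> r \<in> S \<and> s \<notin> S"
  using assms by (induction rule: rtrancl_induct) blast+

section \<open>The metric of the tree\<close>

fun pos :: "vertex \<Rightarrow> nat" where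
  "pos (Vw i) = i" | "pos (Vu j) = 1" | "pos (Vx i) = 2" | "pos Vy = 3"

text \<open>A vertex is located by the index \<open>pos\<close> of its projection to the main path
  and by its distance \<open>height\<close> from that path; vertices of different branches are
  joined through their projections.\<close>

fun height :: "vertex \<Rightarrow> nat" where
  "height (Vw i) = 0" | "height (Vu j) = 1" | "height (Vx i) = i" | "height Vy = 1"

text \<open>Differences of naturals are truncated, so \<open>(i - j) + (j - i)\<close> is the absolute difference.\<close>

fun tdist :: "vertex \<Rightarrow> vertex \<Rightarrow> nat" where
  "tdist (Vu i) (Vu j) = (if i = j then 0 else 2)"
| "tdist (Vx i) (Vx j) = (i - j) + (j - i)"
| "tdist Vy Vy = 0"
| "tdist p q = (pos p - pos q) + (pos q - pos p) + height p + height q"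

lemma tree_metric_tree: "tree_metric (parcs (tree k)) tdist"
proof
  fix p q r s :: vertex
  show "tdist p p = 0" by (cases p) auto
  show "tdist p q = tdist q p" by (cases p; cases q) auto
  show "tdist p s = Suc (tdist p r) \<or> tdist p r = Suc (tdist p s)" if "(r, s) \<in> parcs (tree k)"
    using that by (cases p) (auto simp: tree_def tree_edges_def split: if_splits)
  show "r = s" if "(r, q) \<in> parcs (tree k)" "(s, q) \<in> parcs (tree k)"
    "tdist p q = Suc (tdist p r)" "tdist p q = Suc (tdist p s)"
    using that
    \<comment> \<open>Adjacency to \<open>q\<close> discards most combinations before the split on
      \<open>p\<close>.\<close>
    by (cases q; cases r; cases s; simp add: tree_def tree_edges_def;
        cases p; auto split: if_splits)
qed

section \<open>Orientations of the tree\<close>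

text \<open>Replaces \<open>distance\<close> in all computations; the two agree for a starting
  vertex in the tree.\<close>

definition directed_dist :: "vertex pair_pre_digraph \<Rightarrow> vertex \<Rightarrow> vertex \<Rightarrow> nat" where
  "directed_dist D p q = (if (p, q) \<in> (parcs D)\<^sup>* then tdist p q else 0)"

text \<open>The four kinds of vertices are families indexed by \<open>nat\<close>; the single vertex \<open>y\<^sub>1\<close> is the constant
  family \<open>\<lambda>_. Vy\<close> on the index set \<open>{0}\<close>.\<close>

definition block ::
  "vertex pair_pre_digraph \<Rightarrow> (nat \<Rightarrow> vertex) \<Rightarrow> nat set \<Rightarrow> (nat \<Rightarrow> vertex) \<Rightarrow> nat set \<Rightarrow> nat" where
  "block D f I g J = (\<Sum>i\<in>I. \<Sum>j\<in>J. directed_dist D (f i) (g j))"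

lemma block_le:
  assumes "\<And>i j. i \<in> I \<Longrightarrow> j \<in> J \<Longrightarrow> directed_dist D (f i) (g j) \<le> h i j"
  shows "block D f I g J \<le> (\<Sum>i\<in>I. \<Sum>j\<in>J. h i j)"
  unfolding block_def using assms by (intro sum_mono) blast

lemma block_eq:
  assumes "\<And>i j. i \<in> I \<Longrightarrow> j \<in> J \<Longrightarrow> directed_dist D (f i) (g j) = h i j"
  shows "block D f I g J = (\<Sum>i\<in>I. \<Sum>j\<in>J. h i j)"
  unfolding block_def using assms by (intro sum.cong refl) blast

lemma block_eq_0:
  assumes "\<And>i j. i \<in> I \<Longrightarrow> j \<in> J \<Longrightarrow> directed_dist D (f i) (g j) = 0"
  shows "block D f I g J = 0"
  using block_eq[of I J D f g "\<lambda>_ _. 0"] assms by simp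

text \<open>A pair of vertices of a path contributes its distance for at most one of its two orders.\<close>

lemma sum_antisym_le:
  fixes h :: "nat \<Rightarrow> nat \<Rightarrow> nat"
  assumes "\<And>i j. h i j + h j i \<le> (i - j) + (j - i)"
  shows "(\<Sum>i\<in>I. \<Sum>j\<in>I. h i j) \<le> (\<Sum>i\<in>I. \<Sum>j\<in>I. j - i)"
proof -
  have "2 * (\<Sum>i\<in>I. \<Sum>j\<in>I. h i j) = (\<Sum>i\<in>I. \<Sum>j\<in>I. h i j + h j i)"
    using sum.swap[of h I I] by (simp add: sum.distrib)
  also have "\<dots> \<le> (\<Sum>i\<in>I. \<Sum>j\<in>I. (i - j) + (j - i))"
    by (intro sum_mono assms)
  also have "\<dots> = 2 * (\<Sum>i\<in>I. \<Sum>j\<in>I. j - i)"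
    using sum.swap[of "\<lambda>i j. i - j" I I] by (simp add: sum.distrib)
  finally show ?thesis by simp
qed

text \<open>The bound \<open>3 \<le> k\<close> ensures that \<open>Vw 2\<close> and
  \<open>Vw 3\<close>, which carry branches, are vertices of the tree.\<close>

locale tree_orientation =
  fixes k :: nat and D :: "vertex pair_pre_digraph"
  assumes orientation: "orientation_of D (tree k)" and k_ge: "3 \<le> k"
begin

abbreviation A :: "vertex rel" where "A \<equiv> parcs D"
abbreviation N :: nat where "N \<equiv> k\<^sup>2 div 9"

lemma pverts_D: "pverts D = tree_verts k"
  using orientation by (simp add: orientation_of_def tree_def)

lemma arcs_subset: "A \<subseteq> tree_edges k \<union> (tree_edges k)\<inverse>"
  using orientation by (auto simp add: orientation_of_def tree_def)

lemma arc_iff: "(p, q) \<in> tree_edges k \<Longrightarrow> (q, p) \<in> A \<longleftrightarrow> (p, q) \<notin> A"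
  using orientation by (auto simp add: orientation_of_def tree_def)

lemma tree_edges_subset: "tree_edges k \<subseteq> tree_verts k \<times> tree_verts k"
  using k_ge by (auto simp: tree_edges_def tree_verts_def)

sublocale oriented_tree "parcs (tree k)" tdist A
proof -
  interpret tree_metric "parcs (tree k)" tdist by (rule tree_metric_tree)
  show "oriented_tree (parcs (tree k)) tdist A"
    using orientation by unfold_locales (auto simp: orientation_of_def tree_def sym_def)
qed

lemma distance_eq_directed_dist: "p \<in> tree_verts k \<Longrightarrow> distance (with_proj D) p q = directed_dist D p q"
  unfolding directed_dist_def
  by (rule distance_oriented_tree[OF oriented_tree_axioms])
     (use arcs_subset tree_edges_subset pverts_D in auto)

lemma wiener_index_eq_directed_dist:
  "wiener_index (with_proj D) = (\<Sum>p\<in>tree_verts k. \<Sum>q\<in>tree_verts k. directed_dist D p q)"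
  unfolding wiener_index_def by (simp add: pverts_D distance_eq_directed_dist flip: sum.cartesian_product)

text \<open>The ordered pairs are split by the kinds of their two ends. Of the sixteen blocks, the
  one from \<open>Vy\<close> to itself is zero and does not appear.\<close>

lemma wiener_index_blocks:
  "wiener_index (with_proj D) =
     block D Vu {1..N} Vu {1..N} + block D Vu {1..N} Vw {1..k} +
     block D Vu {1..N} Vx {1..5} + block D Vu {1..N} (\<lambda>_. Vy) {0} +
     block D Vw {1..k} Vu {1..N} + block D Vw {1..k} Vw {1..k} +
     block D Vw {1..k} Vx {1..5} + block D Vw {1..k} (\<lambda>_. Vy) {0} +
     block D Vx {1..5} Vu {1..N} + block D Vx {1..5} Vw {1..k} +
     block D Vx {1..5} Vx {1..5} + block D Vx {1..5} (\<lambda>_. Vy) {0} +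
     block D (\<lambda>_. Vy) {0} Vu {1..N} + block D (\<lambda>_. Vy) {0} Vw {1..k} +
     block D (\<lambda>_. Vy) {0} Vx {1..5}"
proof -
  have *: "(\<Sum>p\<in>tree_verts k. h p) =
    (\<Sum>i=1..k. h (Vw i)) + (\<Sum>i=1..N. h (Vu i)) + (\<Sum>i=1..5. h (Vx i)) + h Vy" for h :: "vertex \<Rightarrow> nat"
  proof -
    have "(\<Sum>p\<in>tree_verts k. h p) =
      sum h (Vw ` {1..k}) + sum h (Vu ` {1..N}) + sum h (Vx ` {1..5}) + sum h {Vy}"
      unfolding tree_verts_def by (subst sum.union_disjoint; auto)+
    then show ?thesis by (simp add: sum.reindex inj_on_def)
  qed
  have "directed_dist D Vy Vy = 0" by (simp add: directed_dist_def)
  then show ?thesis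
    unfolding wiener_index_eq_directed_dist * block_def by (simp add: sum.distrib)
qed

lemma directed_dist_le: "directed_dist D p q \<le> tdist p q"
  by (simp add: directed_dist_def)

lemma directed_dist_antisym: "directed_dist D p q + directed_dist D q p \<le> tdist p q"
  using reach_antisym[of p q] td_sym[of p q] by (auto simp: directed_dist_def)

section \<open>Reachability across single edges\<close>

lemma reach_forward:
  assumes "(p, q) \<in> A\<^sup>*" "pos p \<le> l" "l < pos q"
  shows "(Vw l, Vw (Suc l)) \<in> A"
proof -
  \<comment> \<open>Every edge outside the main path keeps \<open>pos\<close>, so only the edge
    between \<open>Vw l\<close> and \<open>Vw (Suc l)\<close> leaves this set.\<close>
  obtain r s where "(r, s) \<in> A" "pos r \<le> l" "\<not> pos s \<le> l"
    using cut[OF assms(1), of "{v. pos v \<le> l}"] assms by auto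
  moreover from this(1) have "(r, s) \<in> tree_edges k \<or> (s, r) \<in> tree_edges k"
    using arcs_subset by auto
  ultimately have "r = Vw l \<and> s = Vw (Suc l)"
    by (auto simp: tree_edges_def)
  with \<open>(r, s) \<in> A\<close> show ?thesis by simp
qed

lemma reach_backward:
  assumes "(p, q) \<in> A\<^sup>*" "pos q \<le> l" "l < pos p"
  shows "(Vw (Suc l), Vw l) \<in> A"
proof -
  obtain r s where "(r, s) \<in> A" "\<not> pos r \<le> l" "pos s \<le> l"
    using cut[OF assms(1), of "{v. \<not> pos v \<le> l}"] assms by auto
  moreover from this(1) have "(r, s) \<in> tree_edges k \<or> (s, r) \<in> tree_edges k"
    using arcs_subset by auto
  ultimately have "r = Vw (Suc l) \<and> s = Vw l"
    by (auto simp: tree_edges_def)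
  with \<open>(r, s) \<in> A\<close> show ?thesis by simp
qed

lemma reach_from_u: "(Vu j, q) \<in> A\<^sup>* \<Longrightarrow> q \<noteq> Vu j \<Longrightarrow> (Vu j, Vw 1) \<in> A"
  using cut[of "Vu j" q A "{Vu j}"] arcs_subset by (auto simp: tree_edges_def)

lemma reach_to_u: "(p, Vu j) \<in> A\<^sup>* \<Longrightarrow> p \<noteq> Vu j \<Longrightarrow> (Vw 1, Vu j) \<in> A"
  using cut[of p "Vu j" A "- {Vu j}"] arcs_subset by (auto simp: tree_edges_def)

lemma reach_from_y: "(Vy, q) \<in> A\<^sup>* \<Longrightarrow> q \<noteq> Vy \<Longrightarrow> (Vy, Vw 3) \<in> A"
  using cut[of Vy q A "{Vy}"] arcs_subset by (auto simp: tree_edges_def)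

lemma reach_to_y: "(p, Vy) \<in> A\<^sup>* \<Longrightarrow> p \<noteq> Vy \<Longrightarrow> (Vw 3, Vy) \<in> A"
  using cut[of p Vy A "- {Vy}"] arcs_subset by (auto simp: tree_edges_def)

lemma reach_from_x: "(Vx i, q) \<in> A\<^sup>* \<Longrightarrow> q \<notin> range Vx \<Longrightarrow> (Vx 1, Vw 2) \<in> A"
  using cut[of "Vx i" q A "range Vx"] arcs_subset by (auto simp: tree_edges_def)

lemma reach_to_x: "(p, Vx i) \<in> A\<^sup>* \<Longrightarrow> p \<notin> range Vx \<Longrightarrow> (Vw 2, Vx 1) \<in> A"
  using cut[of p "Vx i" A "- range Vx"] arcs_subset by (auto simp: tree_edges_def)

text \<open>The vertices of the \<open>x\<close>-path beyond \<open>Vx l\<close> form a tail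
  attached by one edge. With \<open>1 \<le> l\<close> this edge lies inside the
  \<open>x\<close>-path and is not the one at \<open>Vw 2\<close>.\<close>

lemma reach_to_x_inner:
  assumes "(p, Vx i) \<in> A\<^sup>*" "p \<notin> range Vx" "1 \<le> l" "l < i"
  shows "(Vx l, Vx (Suc l)) \<in> A"
proof -
  obtain r s where "(r, s) \<in> A" "r \<notin> Vx ` {l<..}" "s \<in> Vx ` {l<..}"
    using cut[OF assms(1), of "- Vx ` {l<..}"] assms by auto
  moreover from this(1) have "(r, s) \<in> tree_edges k \<or> (s, r) \<in> tree_edges k"
    using arcs_subset by auto
  ultimately have "r = Vx l \<and> s = Vx (Suc l)"
    using assms(3) by (auto simp: tree_edges_def)
  with \<open>(r, s) \<in> A\<close> show ?thesis by simp
qed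

end

section \<open>Contributions of the blocks of vertex pairs\<close>

lemma sum_restrict_const:
  fixes c :: nat
  assumes "S \<subseteq> T" "finite T"
  shows "(\<Sum>i\<in>T. if i \<in> S then c else 0) = card S * c"
proof -
  have "(\<Sum>i\<in>T. if i \<in> S then c else 0) = (\<Sum>i\<in>T \<inter> S. c)"
    using assms(2) by (simp flip: sum.inter_restrict)
  also have "T \<inter> S = S" using assms by auto
  finally show ?thesis by simp
qed

text \<open>The Wiener index of a directed path on \<open>n\<close> vertices; truncated subtraction
  makes pairs against the direction contribute 0.\<close>

definition path_wiener :: "nat \<Rightarrow> nat" where
  "path_wiener n = (\<Sum>i=1..n. \<Sum>j=1..n. j - i)"

context tree_orientation
begin

text \<open>The two sets split the leaves by the direction of their edge; their cardinalities are
  the numbers \<open>a\<close> and \<open>b\<close> of the outline.\<close>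

definition in_leaves :: "nat set" where "in_leaves = {j \<in> {1..N}. (Vu j, Vw 1) \<in> A}"
definition out_leaves :: "nat set" where "out_leaves = {j \<in> {1..N}. (Vu j, Vw 1) \<notin> A}"

lemma card_leaves: "in_leaves \<subseteq> {1..N}" "out_leaves \<subseteq> {1..N}" "card in_leaves + card out_leaves = N"
proof -
  have "{1..N} = in_leaves \<union> out_leaves" "in_leaves \<inter> out_leaves = {}" "finite in_leaves" "finite out_leaves"
    by (auto simp: in_leaves_def out_leaves_def)
  then show "card in_leaves + card out_leaves = N" by (metis card_Un_disjoint card_atLeastAtMost diff_Suc_1)
qed (auto simp: in_leaves_def out_leaves_def)

text \<open>A walk between two leaves runs through \<open>Vw 1\<close>, so it starts at an ingoing
  leaf, ends at an outgoing one and has length 2.\<close>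

lemma uu_le: "block D Vu {1..N} Vu {1..N} \<le> 2 * card in_leaves * card out_leaves"
proof -
  have "block D Vu {1..N} Vu {1..N} \<le>
      (\<Sum>i=1..N. \<Sum>j=1..N. if i \<in> in_leaves then if j \<in> out_leaves then 2 else 0 else 0)"
  proof (rule block_le)
    fix i j assume ij: "i \<in> {1..N}" "j \<in> {1..N}"
    show "directed_dist D (Vu i) (Vu j) \<le> (if i \<in> in_leaves then if j \<in> out_leaves then 2 else 0 else 0)"
    proof (cases "i \<noteq> j \<and> (Vu i, Vu j) \<in> A\<^sup>*")
      case True
      then have "(Vu i, Vw 1) \<in> A" "(Vw 1, Vu j) \<in> A" using reach_from_u reach_to_u by auto
      then have "i \<in> in_leaves" "j \<in> out_leaves" using ij anti by (auto simp: in_leaves_def out_leaves_def)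
      then show ?thesis by (simp add: directed_dist_def)
    qed (auto simp: directed_dist_def)
  qed
  also have "\<dots> = (\<Sum>i=1..N. if i \<in> in_leaves then card out_leaves * 2 else 0)"
    by (intro sum.cong refl) (simp add: sum_restrict_const card_leaves del: One_nat_def)
  also have "\<dots> = 2 * card in_leaves * card out_leaves"
    by (simp add: sum_restrict_const card_leaves del: One_nat_def)
  finally show ?thesis .
qed

lemma uw_le: "block D Vu {1..N} Vw {1..k} \<le> card in_leaves * \<Sum>{1..k}"
proof -
  have "block D Vu {1..N} Vw {1..k} \<le> (\<Sum>i=1..N. \<Sum>j=1..k. if i \<in> in_leaves then j else 0)"
    by (rule block_le) (use reach_from_u in \<open>auto simp: directed_dist_def in_leaves_def\<close>)
  also have "\<dots> = (\<Sum>i=1..N. if i \<in> in_leaves then \<Sum>{1..k} else 0)"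
    by (intro sum.cong refl) simp
  finally show ?thesis by (simp add: sum_restrict_const card_leaves del: One_nat_def)
qed

text \<open>Wherever the wrong edge lies, no leaf reaches \<open>Vw k\<close>, which is at distance
  \<open>k\<close>; only this loss is recorded.\<close>

lemma uw_le_broken:
  assumes "1 \<le> l" "l < k" "(Vw l, Vw (Suc l)) \<notin> A"
  shows "block D Vu {1..N} Vw {1..k} \<le> card in_leaves * \<Sum>{1..<k}"
proof -
  have "block D Vu {1..N} Vw {1..k} \<le>
      (\<Sum>i=1..N. \<Sum>j=1..k. if i \<in> in_leaves then if j < k then j else 0 else 0)"
  proof (rule block_le)
    fix i j assume ij: "i \<in> {1..N}" "j \<in> {1..k}"
    have "j < k" if "(Vu i, Vw j) \<in> A\<^sup>*"
      using reach_forward[OF that, of l] assms ij by (cases "j = k") auto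
    then show "directed_dist D (Vu i) (Vw j) \<le> (if i \<in> in_leaves then if j < k then j else 0 else 0)"
      using reach_from_u ij by (auto simp: directed_dist_def in_leaves_def)
  qed
  also have "(\<Sum>j=1..k. if j < k then j else 0) = \<Sum>{1..<k}"
  proof -
    have "{1..k} = insert k {1..<k}" using k_ge by auto
    then show ?thesis by simp
  qed
  then have "(\<Sum>i=1..N. \<Sum>j=1..k. if i \<in> in_leaves then if j < k then j else 0 else 0) =
      (\<Sum>i=1..N. if i \<in> in_leaves then \<Sum>{1..<k} else 0)"
    by (intro sum.cong refl) simp
  finally show ?thesis by (simp add: sum_restrict_const card_leaves del: One_nat_def)
qed

lemma ww_le: "block D Vw {1..k} Vw {1..k} \<le> path_wiener k"
proof -
  have "directed_dist D (Vw i) (Vw j) + directed_dist D (Vw j) (Vw i) \<le> (i - j) + (j - i)" for i j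
    using directed_dist_antisym[of "Vw i" "Vw j"] by simp
  then show ?thesis unfolding block_def path_wiener_def by (rule sum_antisym_le)
qed

lemma xx_le: "block D Vx {1..5} Vx {1..5} \<le> 20"
proof -
  have "directed_dist D (Vx i) (Vx j) + directed_dist D (Vx j) (Vx i) \<le> (i - j) + (j - i)" for i j
    using directed_dist_antisym[of "Vx i" "Vx j"] by simp
  then have "block D Vx {1..5} Vx {1..5} \<le> path_wiener 5"
    unfolding block_def path_wiener_def by (rule sum_antisym_le)
  \<comment> \<open>\<open>4 * 1 + 3 * 2 + 2 * 3 + 1 * 4\<close>, counting pairs by their
    distance.\<close>
  also have "path_wiener 5 = 20" by (simp add: path_wiener_def numeral_eq_Suc)
  finally show ?thesis .
qed

text \<open>Positions differ by less than \<open>k\<close>, and each height is at most 5.\<close>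

lemma tdist_le: "\<lbrakk>p \<in> tree_verts k; q \<in> tree_verts k\<rbrakk> \<Longrightarrow> tdist p q \<le> k + 10"
  using k_ge by (cases p; cases q) (auto simp: tree_verts_def)

lemma block_crude:
  assumes "f ` I \<subseteq> tree_verts k" "g ` J \<subseteq> tree_verts k"
  shows "block D f I g J \<le> card I * card J * (k + 10)"
proof -
  have "block D f I g J \<le> (\<Sum>i\<in>I. \<Sum>j\<in>J. k + 10)"
    by (rule block_le, rule order_trans[OF directed_dist_le tdist_le]) (use assms in auto)
  then show ?thesis by (simp add: algebra_simps)
qed

lemma ux_le: "block D Vu {1..N} Vx {1..5} \<le> 25 * N"
proof -
  have "block D Vu {1..N} Vx {1..5} \<le> (\<Sum>i=1..N. \<Sum>j=1..5. j + 2)"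
    by (rule block_le, rule order_trans[OF directed_dist_le]) simp
  also have "(\<Sum>j=1..5::nat. j + 2) = 25" by (simp add: numeral_eq_Suc)
  finally show ?thesis by (simp add: algebra_simps)
qed

text \<open>A wrong edge in the \<open>x\<close>-path cuts off \<open>Vx 5\<close>, at distance 7
  from each leaf, so 25 drops to 18.\<close>

lemma ux_le_broken:
  assumes "1 \<le> l" "l < 5" "(Vx l, Vx (Suc l)) \<notin> A"
  shows "block D Vu {1..N} Vx {1..5} \<le> 18 * N"
proof -
  have "block D Vu {1..N} Vx {1..5} \<le> (\<Sum>i=1..N. \<Sum>j=1..5. if j < 5 then j + 2 else 0)"
  proof (rule block_le)
    fix i j assume ij: "i \<in> {1..N}" "j \<in> {1..5::nat}"
    have "j < 5" if "(Vu i, Vx j) \<in> A\<^sup>*"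
      using reach_to_x_inner[OF that, of l] assms ij by (cases "j = 5") auto
    then show "directed_dist D (Vu i) (Vx j) \<le> (if j < 5 then j + 2 else 0)"
      by (auto simp: directed_dist_def)
  qed
  also have "(\<Sum>j=1..5::nat. if j < 5 then j + 2 else 0) = 18" by (simp add: numeral_eq_Suc)
  finally show ?thesis by (simp add: algebra_simps)
qed

lemma uy_le: "block D Vu {1..N} (\<lambda>_. Vy) {0} \<le> 4 * N"
proof -
  have "block D Vu {1..N} (\<lambda>_. Vy) {0} \<le> (\<Sum>i=1..N. \<Sum>j\<in>{0::nat}. 4)"
    by (rule block_le, rule order_trans[OF directed_dist_le]) simp
  then show ?thesis by simp
qed

lemma xy_le: "block D Vx {1..5} (\<lambda>_. Vy) {0} \<le> 25"
proof -
  have "block D Vx {1..5} (\<lambda>_. Vy) {0} \<le> (\<Sum>i=1..5. \<Sum>j\<in>{0::nat}. i + 2)"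
    by (rule block_le, rule order_trans[OF directed_dist_le]) simp
  also have "\<dots> = 25" by (simp add: numeral_eq_Suc)
  finally show ?thesis .
qed

lemma yx_le: "block D (\<lambda>_. Vy) {0} Vx {1..5} \<le> 25"
proof -
  have "block D (\<lambda>_. Vy) {0} Vx {1..5} \<le> (\<Sum>j\<in>{0::nat}. \<Sum>i=1..5. i + 2)"
    by (rule block_le, rule order_trans[OF directed_dist_le]) simp
  also have "\<dots> = 25" by (simp add: numeral_eq_Suc)
  finally show ?thesis .
qed

text \<open>The sole edge at \<open>Vy\<close> cannot be used in both directions. The edge between
  \<open>Vw 2\<close> and \<open>Vx 1\<close> plays the same part for the \<open>x\<close>-path in
  the lemmas that follow.\<close>

lemma y_in_eq_0:
  assumes "(Vy, Vw 3) \<in> A"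
  shows "block D Vu {1..N} (\<lambda>_. Vy) {0} = 0" "block D Vw {1..k} (\<lambda>_. Vy) {0} = 0"
proof -
  have "(p, Vy) \<notin> A\<^sup>*" if "p \<noteq> Vy" for p
    using reach_to_y[of p] assms anti that by blast
  then show "block D Vu {1..N} (\<lambda>_. Vy) {0} = 0" "block D Vw {1..k} (\<lambda>_. Vy) {0} = 0"
    by (auto intro!: block_eq_0 simp: directed_dist_def)
qed

lemma y_out_eq_0:
  assumes "(Vw 3, Vy) \<in> A"
  shows "block D (\<lambda>_. Vy) {0} Vw {1..k} = 0"
proof -
  have "(Vy, q) \<notin> A\<^sup>*" if "q \<noteq> Vy" for q
    using reach_from_y[of q] assms anti that by blast
  then show ?thesis by (auto intro!: block_eq_0 simp: directed_dist_def)
qed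

lemma x_out_eq_0:
  assumes "(Vw 2, Vx 1) \<in> A"
  shows "block D Vx {1..5} Vw {1..k} = 0" "block D Vx {1..5} (\<lambda>_. Vy) {0} = 0"
proof -
  have "(Vx i, q) \<notin> A\<^sup>*" if "q \<notin> range Vx" for i q
    using reach_from_x[of i q] assms anti that by blast
  then show "block D Vx {1..5} Vw {1..k} = 0" "block D Vx {1..5} (\<lambda>_. Vy) {0} = 0"
    by (auto intro!: block_eq_0 simp: directed_dist_def image_iff)
qed

lemma x_in_eq_0:
  assumes "(Vx 1, Vw 2) \<in> A"
  shows "block D Vu {1..N} Vx {1..5} = 0" "block D Vw {1..k} Vx {1..5} = 0"
proof -
  have "(p, Vx i) \<notin> A\<^sup>*" if "p \<notin> range Vx" for i p
    using reach_to_x[of p i] assms anti that by blast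
  then show "block D Vu {1..N} Vx {1..5} = 0" "block D Vw {1..k} Vx {1..5} = 0"
    by (auto intro!: block_eq_0 simp: directed_dist_def image_iff)
qed

end

section \<open>Bounds under the normalisation of the first path edge\<close>

locale forward_orientation = tree_orientation +
  assumes w12: "(Vw 1, Vw 2) \<in> A"
begin

lemma not_w21: "(Vw 2, Vw 1) \<notin> A"
  using w12 anti by blast

text \<open>Later path vertices would have to traverse the first edge backwards, so only
  \<open>Vw 1\<close> reaches leaves, namely outgoing ones, each at distance 1.\<close>

lemma wu_le: "block D Vw {1..k} Vu {1..N} \<le> card out_leaves"
proof -
  have "block D Vw {1..k} Vu {1..N} \<le>
      (\<Sum>i=1..k. \<Sum>j=1..N. if i \<in> {1} then if j \<in> out_leaves then 1 else 0 else 0)"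
  proof (rule block_le)
    fix i j assume ij: "i \<in> {1..k}" "j \<in> {1..N}"
    show "directed_dist D (Vw i) (Vu j) \<le> (if i \<in> {1} then if j \<in> out_leaves then 1 else 0 else 0)"
    proof (cases "(Vw i, Vu j) \<in> A\<^sup>*")
      case True
      then have "(Vw 1, Vu j) \<in> A" using reach_to_u by auto
      then have "j \<in> out_leaves" using ij anti by (auto simp: out_leaves_def)
      moreover have "i = 1"
        using reach_backward[OF True, of 1] ij not_w21 by (cases "i = 1") (auto simp: numeral_2_eq_2)
      ultimately show ?thesis by (simp add: directed_dist_def)
    qed (simp add: directed_dist_def)
  qed
  also have "\<dots> = (\<Sum>i=1..k. if i \<in> {1} then card out_leaves else 0)"
    by (intro sum.cong refl) (simp add: sum_restrict_const card_leaves del: One_nat_def)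
  also have "\<dots> = card out_leaves"
    using k_ge by (subst sum_restrict_const) auto
  finally show ?thesis .
qed

lemma xu_yu_eq_0:
  "block D Vx {1..5} Vu {1..N} = 0" "block D (\<lambda>_. Vy) {0} Vu {1..N} = 0"
proof -
  have "(p, Vu j) \<notin> A\<^sup>*" if "1 < pos p" for p j
    using reach_backward[of p "Vu j" 1] that not_w21 by (auto simp: numeral_2_eq_2)
  then show "block D Vx {1..5} Vu {1..N} = 0" "block D (\<lambda>_. Vy) {0} Vu {1..N} = 0"
    by (auto intro!: block_eq_0 simp: directed_dist_def)
qed

text \<open>Here \<open>29 = 25 + 4\<close> bounds the distances from a leaf to the
  \<open>x\<close>-path and \<open>Vy\<close>, the factor \<open>12 * k\<close> counts the ordered
  pairs between the main path and these six vertices, and \<open>70 = 25 + 25 + 20\<close> covers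
  the pairs among the six.\<close>

lemma wiener_index_broken:
  assumes "1 \<le> l" "l < k" "(Vw l, Vw (Suc l)) \<notin> A"
  shows "wiener_index (with_proj D) \<le>
    2 * card in_leaves * card out_leaves + card out_leaves + card in_leaves * \<Sum>{1..<k} +
    path_wiener k + 29 * N + 12 * k * (k + 10) + 70"
proof -
  have V: "Vw ` {1..k} \<subseteq> tree_verts k" "Vx ` {1..5} \<subseteq> tree_verts k" "(\<lambda>_. Vy) ` {0::nat} \<subseteq> tree_verts k"
    by (auto simp: tree_verts_def)
  show ?thesis
    unfolding wiener_index_blocks
    using uu_le uw_le_broken[OF assms] ww_le wu_le xu_yu_eq_0 ux_le uy_le xy_le yx_le xx_le
      block_crude[OF V(1,2)] block_crude[OF V(2,1)] block_crude[OF V(1,3)] block_crude[OF V(3,1)]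
    by simp
qed

end

section \<open>Forward directed main path\<close>

lemma double_sum_less: "2 * \<Sum>{1..<k} + k = k\<^sup>2" for k :: nat
proof (induction k)
  case (Suc k)
  then show ?case by (cases k) (auto simp: power2_eq_square)
qed simp

text \<open>The sum is \<open>(k - 1) * (k - 2) / 2\<close>; the negative term is moved to the left
  to avoid truncated subtraction.\<close>

lemma double_sum_shifted: "1 \<le> k \<Longrightarrow> 2 * (\<Sum>l=1..k. l - 2) + 3 * k = k\<^sup>2 + 2" for k :: nat
proof (induction k rule: nat_induct_at_least)
  case (Suc k)
  then show ?case by (auto simp: power2_eq_square)
qed simp

text \<open>Here \<open>55 = 35 + 20\<close> counts the pairs from \<open>w\<^sub>1, w\<^sub>2\<close> to the \<open>x\<close>-path and those inside the \<open>x\<close>-path,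
  and \<open>l - 2\<close> is truncated to \<open>0\<close> for the \<open>w\<^sub>l\<close> that \<open>y\<^sub>1\<close> does not reach.\<close>

definition opt_value :: "nat \<Rightarrow> nat" where
  "opt_value k = (k\<^sup>2 div 9) * \<Sum>{1..k} + 25 * (k\<^sup>2 div 9) + path_wiener k + 55 + (\<Sum>l=1..k. l - 2)"

lemma tree_verts_iff:
  "Vw i \<in> tree_verts k \<longleftrightarrow> 1 \<le> i \<and> i \<le> k"
  "Vu i \<in> tree_verts k \<longleftrightarrow> 1 \<le> i \<and> i \<le> k\<^sup>2 div 9"
  "Vx i \<in> tree_verts k \<longleftrightarrow> 1 \<le> i \<and> i \<le> 5"
  "Vy \<in> tree_verts k"
  by (auto simp: tree_verts_def)

locale straight_orientation = tree_orientation +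
  assumes straight: "\<lbrakk>1 \<le> l; l < k\<rbrakk> \<Longrightarrow> (Vw l, Vw (Suc l)) \<in> A"

sublocale straight_orientation \<subseteq> forward_orientation
  using straight[of 1] k_ge by unfold_locales (auto simp: numeral_2_eq_2)

context straight_orientation
begin

text \<open>Moving to a smaller position would cross the main path edge following position
  \<open>pos q\<close> backwards.\<close>

lemma reach_pos_mono:
  assumes "(p, q) \<in> A\<^sup>*" "p \<in> tree_verts k" "q \<in> tree_verts k"
  shows "pos p \<le> pos q"
proof (rule ccontr)
  assume "\<not> pos p \<le> pos q"
  moreover have "pos p \<le> k" "1 \<le> pos q" using assms k_ge by (auto simp: tree_verts_def)
  ultimately show False
    using reach_backward[OF assms(1), of "pos q"] straight[of "pos q"] anti by auto
qed

text \<open>Only \<open>Vw 1\<close> and \<open>Vw 2\<close> lie early enough; they contribute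
  \<open>20 + 15\<close>.\<close>

lemma wx_le: "block D Vw {1..k} Vx {1..5} \<le> 35"
proof -
  have "block D Vw {1..k} Vx {1..5} \<le> (\<Sum>l=1..k. \<Sum>i=1..5. if l \<le> 2 then (2 - l) + i else 0)"
    by (rule block_le, subst directed_dist_def)
      (use reach_pos_mono[of "Vw i" "Vx j" for i j] in \<open>auto simp: tree_verts_iff\<close>)
  also have "\<dots> = (\<Sum>l\<in>insert 1 (insert 2 {3..k}). \<Sum>i=1..5. if l \<le> 2 then (2 - l) + i else 0)"
    using k_ge by (intro sum.cong) auto
  also have "\<dots> = 35"
    by (simp add: numeral_eq_Suc)
  finally show ?thesis .
qed

text \<open>The vertices \<open>Vw 1\<close>, \<open>Vw 2\<close>, \<open>Vw 3\<close> contribute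
  \<open>3 + 2 + 1\<close>; for later ones \<open>4 - l\<close> is truncated to 0, as it should
  be.\<close>

lemma wy_le: "block D Vw {1..k} (\<lambda>_. Vy) {0} \<le> 6"
proof -
  have "directed_dist D (Vw l) Vy \<le> 4 - l" if "l \<in> {1..k}" for l
    using reach_pos_mono[of "Vw l" Vy] that by (auto simp: directed_dist_def tree_verts_iff)
  then have "block D Vw {1..k} (\<lambda>_. Vy) {0} \<le> (\<Sum>l=1..k. \<Sum>i\<in>{0::nat}. 4 - l)"
    by (rule block_le)
  also have "\<dots> = (\<Sum>l\<in>insert 1 (insert 2 (insert 3 {4..k})). 4 - l)"
    using k_ge by (intro sum.cong) auto
  also have "\<dots> = 6" by simp
  finally show ?thesis .
qed

lemma yw_le: "block D (\<lambda>_. Vy) {0} Vw {1..k} \<le> (\<Sum>l=1..k. l - 2)"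
proof -
  have "directed_dist D Vy (Vw l) \<le> l - 2" if "l \<in> {1..k}" for l
    using reach_pos_mono[of Vy "Vw l"] that by (auto simp: directed_dist_def tree_verts_iff)
  then have "block D (\<lambda>_. Vy) {0} Vw {1..k} \<le> (\<Sum>i\<in>{0::nat}. \<Sum>l=1..k. l - 2)"
    by (rule block_le)
  then show ?thesis by simp
qed

text \<open>For \<open>l \<ge> 2\<close> the distance from \<open>Vx i\<close> to
  \<open>Vw l\<close> is \<open>i + (l - 2)\<close>; for the unreachable \<open>Vw 1\<close> the
  bound \<open>i\<close> is merely generous.\<close>

lemma xw_le: "block D Vx {1..5} Vw {1..k} \<le> 15 * k + 5 * (\<Sum>l=1..k. l - 2)"
proof -
  have "block D Vx {1..5} Vw {1..k} \<le> (\<Sum>i=1..5. \<Sum>l=1..k. i + (l - 2))"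
    by (rule block_le, subst directed_dist_def)
      (use reach_pos_mono[of "Vx i" "Vw j" for i j] in \<open>auto simp: tree_verts_iff\<close>)
  also have "\<dots> = 15 * k + 5 * (\<Sum>l=1..k. l - 2)"
    by (simp add: sum.distrib numeral_eq_Suc)
  finally show ?thesis .
qed

lemma yx_eq_0: "block D (\<lambda>_. Vy) {0} Vx {1..5} = 0"
  by (rule block_eq_0, subst directed_dist_def)
      (use reach_pos_mono[of Vy "Vx j" for j] in \<open>auto simp: tree_verts_iff\<close>)

end

section \<open>The value of the optimal orientation\<close>

lemma arcs_opt:
  "\<lbrakk>1 \<le> i; i < k\<rbrakk> \<Longrightarrow> (Vw i, Vw (Suc i)) \<in> parcs (opt_orientation k)"
  "\<lbrakk>1 \<le> j; j \<le> k\<^sup>2 div 9\<rbrakk> \<Longrightarrow> (Vu j, Vw 1) \<in> parcs (opt_orientation k)"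
  "(Vw 2, Vx 1) \<in> parcs (opt_orientation k)"
  "\<lbrakk>1 \<le> i; i < 5\<rbrakk> \<Longrightarrow> (Vx i, Vx (Suc i)) \<in> parcs (opt_orientation k)"
  "(Vy, Vw 3) \<in> parcs (opt_orientation k)"
  by (auto simp: opt_orientation_def)

lemma straight_opt_orientation: "3 \<le> k \<Longrightarrow> straight_orientation k (opt_orientation k)"
  by unfold_locales (auto intro: orientation_of_opt_orientation arcs_opt)

text \<open>A lower bound suffices, because this orientation is itself straight and so falls under
  the upper bound \<open>straight_le\<close>.\<close>

lemma wiener_index_opt_ge:
  assumes "3 \<le> k"
  shows "opt_value k \<le> wiener_index (with_proj (opt_orientation k))"
proof -
  interpret straight_orientation k "opt_orientation k" by (rule straight_opt_orientation[OF assms])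
  have ww: "(Vw i, Vw j) \<in> A\<^sup>*" if "i \<le> j" "1 \<le> i" "j \<le> k" for i j
    using that
  proof (induction j rule: dec_induct)
    case (step n)
    then show ?case using arcs_opt(1)[of n k] by (auto intro: rtrancl_into_rtrancl)
  qed simp
  have xx: "(Vx i, Vx j) \<in> A\<^sup>*" if "i \<le> j" "1 \<le> i" "j \<le> 5" for i j
    using that
  proof (induction j rule: dec_induct)
    case (step n)
    then show ?case using arcs_opt(4)[of n k] by (auto intro: rtrancl_into_rtrancl)
  qed simp
  have uw: "(Vu j, Vw i) \<in> A\<^sup>*" if "1 \<le> j" "j \<le> N" "1 \<le> i" "i \<le> k" for i j
    using arcs_opt(2)[OF that(1,2)] ww[of 1 i] that(3,4) by (auto intro: converse_rtrancl_into_rtrancl)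
  have w2x: "(Vw 2, Vx i) \<in> A\<^sup>*" if "1 \<le> i" "i \<le> 5" for i
    using arcs_opt(3) xx[of 1 i] that by (auto intro: converse_rtrancl_into_rtrancl)
  have wx: "(Vw l, Vx i) \<in> A\<^sup>*" if "1 \<le> l" "l \<le> 2" "1 \<le> i" "i \<le> 5" for l i
    using rtrancl_trans[OF ww[of l 2] w2x] that assms by auto
  have ux: "(Vu j, Vx i) \<in> A\<^sup>*" if "1 \<le> j" "j \<le> N" "1 \<le> i" "i \<le> 5" for i j
    using rtrancl_trans[OF uw[of j 2] w2x] that assms by auto
  have yw: "(Vy, Vw l) \<in> A\<^sup>*" if "3 \<le> l" "l \<le> k" for l
    using arcs_opt(5) ww[of 3 l] that by (auto intro: converse_rtrancl_into_rtrancl)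
  have "block (opt_orientation k) Vu {1..N} Vw {1..k} = (\<Sum>j=1..N. \<Sum>{1..k})"
    by (rule block_eq) (use uw in \<open>auto simp: directed_dist_def\<close>)
  moreover have "block (opt_orientation k) Vu {1..N} Vx {1..5} = (\<Sum>j=1..N. \<Sum>i=1..5. i + 2)"
    by (rule block_eq) (use ux in \<open>auto simp: directed_dist_def\<close>)
  moreover have "(\<Sum>i=1..5::nat. i + 2) = 25" by (simp add: numeral_eq_Suc)
  moreover have "path_wiener k \<le> block (opt_orientation k) Vw {1..k} Vw {1..k}"
    unfolding path_wiener_def block_def 
  proof (intro sum_mono)
    fix i j assume "i \<in> {1..k}" "j \<in> {1..k}"
    then show "j - i \<le> directed_dist (opt_orientation k) (Vw i) (Vw j)"
      using ww[of i j] by (cases "i \<le> j") (auto simp: directed_dist_def)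
  qed
  moreover have "path_wiener 5 \<le> block (opt_orientation k) Vx {1..5} Vx {1..5}"
    unfolding path_wiener_def block_def 
  proof (intro sum_mono)
    fix i j :: nat assume "i \<in> {1..5}" "j \<in> {1..5}"
    then show "j - i \<le> directed_dist (opt_orientation k) (Vx i) (Vx j)"
      using xx[of i j] by (cases "i \<le> j") (auto simp: directed_dist_def)
  qed
  moreover have "path_wiener 5 = 20" by (simp add: path_wiener_def numeral_eq_Suc)
  moreover have "35 \<le> block (opt_orientation k) Vw {1..k} Vx {1..5}"
  proof -
    have "(35 :: nat) = (\<Sum>l\<in>{1,2}. \<Sum>i=1..5. (2 - l) + i)" by (simp add: numeral_eq_Suc)
    also have "\<dots> = block (opt_orientation k) Vw {1,2} Vx {1..5}"
      by (rule block_eq[symmetric]) (use wx in \<open>auto simp: directed_dist_def\<close>)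
    also have "\<dots> \<le> block (opt_orientation k) Vw {1..k} Vx {1..5}"
      unfolding block_def using assms by (intro sum_mono2) auto
    finally show ?thesis .
  qed
  moreover have "(\<Sum>l=1..k. l - 2) \<le> block (opt_orientation k) (\<lambda>_. Vy) {0} Vw {1..k}"
  proof -
    have "l - 2 \<le> directed_dist (opt_orientation k) Vy (Vw l)" if "l \<in> {1..k}" for l
      using yw[of l] that by (cases "3 \<le> l") (auto simp: directed_dist_def)
    then show ?thesis unfolding block_def by (auto intro!: sum_mono)
  qed
  ultimately show ?thesis
    unfolding wiener_index_blocks opt_value_def by simp
qed

section \<open>Comparison with the optimal orientation\<close>

text \<open>Reversing the \<open>b\<close> outgoing leaves gains \<open>b * (M - 2 * a - 1)\<close>, where \<open>M\<close> is the total distance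
  from an ingoing leaf to the path.\<close>

lemma leaf_exchange:
  fixes a b M :: nat
  assumes "2 * (a + b) + 1 < M"
  shows "2 * a * b + b + a * M \<le> (a + b) * M"
    and "0 < b \<Longrightarrow> 2 * a * b + b + a * M < (a + b) * M"
proof -
  have *: "2 * a * b + b + a * M = b * (2 * a + 1) + a * M" by (simp add: algebra_simps)
  have "b * (2 * a + 1) \<le> b * M" using assms by (intro mult_le_mono) auto
  then show "2 * a * b + b + a * M \<le> (a + b) * M" unfolding * by (simp add: algebra_simps)
  assume "0 < b"
  then have "b * (2 * a + 1) < b * M" using assms by (intro mult_strict_left_mono) auto
  then show "2 * a * b + b + a * M < (a + b) * M" unfolding * by (simp add: algebra_simps)
qed

text \<open>Divisibility makes \<open>k\<^sup>2 div 9\<close> exact, and 1000 leaves ample room for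
  quadratic surpluses to exceed linear terms.\<close>

locale large_tree =
  fixes k :: nat
  assumes k_large: "1000 \<le> k" and dvd_k: "3 dvd k"
begin

lemma nine_N: "9 * (k\<^sup>2 div 9) = k\<^sup>2"
  using dvd_k by (auto simp: dvd_def power_mult_distrib)

text \<open>Together with \<open>nine_N\<close> this lets later comparisons be treated as linear in
  \<open>k\<close> and \<open>k\<^sup>2\<close>.\<close>

lemma k_square_ge: "1000 * k \<le> k\<^sup>2"
  using k_large by (simp add: power2_eq_square)

text \<open>About \<open>2 * k\<^sup>2 / 9\<close> against \<open>k\<^sup>2 / 2\<close>; this is the
  hypothesis of \<open>leaf_exchange\<close>, even for a path without its last vertex.\<close>

lemma leaf_bound: "2 * (k\<^sup>2 div 9) + 1 < \<Sum>{1..<k}"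
  using nine_N k_square_ge double_sum_less[of k] k_large by linarith

lemma sum_atMost_k: "\<Sum>{1..k} = \<Sum>{1..<k} + k"
proof -
  have "{1..k} = insert k {1..<k}" using k_large by auto
  then show ?thesis by simp
qed

text \<open>Losing \<open>Vw k\<close> costs \<open>N * k\<close>, which is cubic in
  \<open>k\<close>, while the error terms of \<open>wiener_index_broken\<close> are
  quadratic.\<close>

lemma broken_less:
  assumes "forward_orientation k D" "1 \<le> l" "l < k" "(Vw l, Vw (Suc l)) \<notin> parcs D"
  shows "wiener_index (with_proj D) < opt_value k"
proof -
  interpret forward_orientation k D by fact
  have "wiener_index (with_proj D) \<le> N * \<Sum>{1..<k} + path_wiener k + 29 * N + 12 * k * (k + 10) + 70"
    using wiener_index_broken[OF assms(2-)] leaf_exchange(1)[of "card in_leaves" "card out_leaves" "\<Sum>{1..<k}"]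
      leaf_bound card_leaves(3) by simp
  also have "\<dots> < N * \<Sum>{1..<k} + path_wiener k + 25 * N + N * k"
  proof -
    \<comment> \<open>The factor 9 clears the division in \<open>N\<close>.\<close>
    have "9 * (29 * N + 12 * k * (k + 10) + 70) = 29 * k\<^sup>2 + 108 * k\<^sup>2 + 1080 * k + 630"
      using nine_N by (simp add: algebra_simps power2_eq_square)
    also have "\<dots> < 25 * k\<^sup>2 + 1000 * k\<^sup>2"
      using k_square_ge k_large by linarith
    also have "\<dots> \<le> 25 * k\<^sup>2 + k * k\<^sup>2"
      using k_large by (intro add_left_mono mult_right_mono) auto
    also have "\<dots> = 25 * (9 * N) + k * (9 * N)"
      unfolding nine_N ..
    also have "\<dots> = 9 * (25 * N + N * k)"
      by (simp only: algebra_simps)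
    finally have "29 * N + 12 * k * (k + 10) + 70 < 25 * N + N * k" by simp
    then show ?thesis by (simp only: add.assoc add_less_cancel_left)
  qed
  also have "\<dots> \<le> opt_value k"
    unfolding opt_value_def sum_atMost_k by (simp add: algebra_simps)
  finally show ?thesis .
qed

text \<open>Apart from the main path, the blocks fall into three groups governed by the leaves, the
  \<open>x\<close>-path and \<open>Vy\<close>. Each group is bounded by its share of
  \<open>opt_value\<close>, strictly unless its edges are oriented as in the optimum, so equality
  fixes every edge.\<close>

lemma straight_le:
  assumes "straight_orientation k D"
  shows "wiener_index (with_proj D) \<le> opt_value k"
    and "wiener_index (with_proj D) = opt_value k \<Longrightarrow> D = opt_orientation k"
proof -
  interpret straight_orientation k D by fact
  let ?T = "\<Sum>l=1..k. l - 2"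
  let ?u = "block D Vu {1..N} Vu {1..N} + block D Vw {1..k} Vu {1..N} + block D Vu {1..N} Vw {1..k}"
  let ?x = "block D Vu {1..N} Vx {1..5} + block D Vw {1..k} Vx {1..5} + block D Vx {1..5} Vw {1..k}
    + block D Vx {1..5} Vx {1..5} + block D Vx {1..5} (\<lambda>_. Vy) {0}"
  let ?y = "block D Vu {1..N} (\<lambda>_. Vy) {0} + block D Vw {1..k} (\<lambda>_. Vy) {0}
    + block D (\<lambda>_. Vy) {0} Vw {1..k}"
  have W: "wiener_index (with_proj D) = ?u + ?x + ?y + block D Vw {1..k} Vw {1..k}"
    unfolding wiener_index_blocks using xu_yu_eq_0 yx_eq_0 by simp
  have T: "2 * ?T + 3 * k = k\<^sup>2 + 2"
    using double_sum_shifted k_ge by simp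
  have u0: "?u \<le> 2 * card in_leaves * card out_leaves + card out_leaves + card in_leaves * \<Sum>{1..k}"
    using uu_le wu_le uw_le by linarith
  have M: "2 * (card in_leaves + card out_leaves) + 1 < \<Sum>{1..k}"
    unfolding card_leaves(3) sum_atMost_k using leaf_bound by simp
  have u: "?u \<le> N * \<Sum>{1..k}" and u_less: "out_leaves \<noteq> {} \<Longrightarrow> ?u < N * \<Sum>{1..k}"
  proof -
    show "?u \<le> N * \<Sum>{1..k}"
      using u0 leaf_exchange(1)[OF M] unfolding card_leaves(3) by linarith
    assume "out_leaves \<noteq> {}"
    then have "0 < card out_leaves" by (simp add: card_gt_0_iff out_leaves_def)
    then show "?u < N * \<Sum>{1..k}"
      using u0 leaf_exchange(2)[OF M] unfolding card_leaves(3) by linarith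
  qed
  have y: "?y \<le> ?T" and y_less: "(Vy, Vw 3) \<notin> A \<Longrightarrow> ?y < ?T"
  proof -
    have *: "(Vw 3, Vy) \<in> A" if "(Vy, Vw 3) \<notin> A"
      using arc_iff[of "Vw 3" Vy] that by (auto simp: tree_edges_def)
    \<comment> \<open>At most \<open>4 * N + 6\<close>, about \<open>4 * k\<^sup>2 / 9\<close>,
      against roughly \<open>k\<^sup>2 / 2\<close> for \<open>?T\<close>.\<close>
    show less: "?y < ?T" if "(Vy, Vw 3) \<notin> A"
      using y_out_eq_0[OF *[OF that]] uy_le wy_le T nine_N k_square_ge k_large by linarith
    show "?y \<le> ?T"
      using less y_in_eq_0 yw_le by (cases "(Vy, Vw 3) \<in> A") auto
  qed
  define x_out where "x_out \<longleftrightarrow> (Vw 2, Vx 1) \<in> A \<and> (\<forall>l. 1 \<le> l \<longrightarrow> l < 5 \<longrightarrow> (Vx l, Vx (Suc l)) \<in> A)"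
  have x: "?x \<le> 25 * N + 55" and x_less: "\<not> x_out \<Longrightarrow> ?x < 25 * N + 55"
  proof -
    show less: "?x < 25 * N + 55" if "\<not> x_out"
    proof (cases "(Vw 2, Vx 1) \<in> A")
      case True
      with that obtain l where "1 \<le> l" "l < 5" "(Vx l, Vx (Suc l)) \<notin> A"
        by (auto simp: x_out_def)
      from ux_le_broken[OF this] show ?thesis
        using x_out_eq_0[OF True] wx_le xx_le nine_N k_square_ge k_large by linarith
    next
      case False
      then have "(Vx 1, Vw 2) \<in> A"
        using arc_iff[of "Vw 2" "Vx 1"] by (auto simp: tree_edges_def)
      \<comment> \<open>At most \<open>15 * k + 5 * ?T + 20 + 25\<close>, with leading term
        \<open>5 * k\<^sup>2 / 2\<close> below \<open>25 * k\<^sup>2 / 9\<close>.\<close>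
      from x_in_eq_0[OF this] show ?thesis
        using xw_le xx_le xy_le T nine_N k_square_ge k_large by linarith
    qed
    show "?x \<le> 25 * N + 55"
    proof (cases x_out)
      case True
      then show ?thesis using x_out_eq_0 ux_le wx_le xx_le unfolding x_out_def by linarith
    qed (use less in simp)
  qed
  show "wiener_index (with_proj D) \<le> opt_value k"
    unfolding W opt_value_def using u x y ww_le by linarith
  assume eq: "wiener_index (with_proj D) = opt_value k"
  then have le: "N * \<Sum>{1..k} + (25 * N + 55) + ?T \<le> ?u + ?x + ?y"
    unfolding W opt_value_def using ww_le by linarith
  have "out_leaves = {}" using le u_less x y by linarith
  moreover have "(Vy, Vw 3) \<in> A" using le y_less u x by linarith
  moreover have "x_out" using le x_less u y by linarith
  ultimately have *: "parcs (opt_orientation k) \<subseteq> A"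
    using straight by (auto simp: opt_orientation_def out_leaves_def x_out_def)
  \<comment> \<open>Both orientations contain exactly one arc of each edge, so one inclusion yields
    the other.\<close>
  have "A \<subseteq> parcs (opt_orientation k)"
  proof
    fix e assume e: "e \<in> A"
    obtain p q where pq: "e = (p, q)" by (cases e)
    with e subE have "(p, q) \<in> parcs (tree k)" by auto
    then have "(p, q) \<in> parcs (opt_orientation k) \<or> (q, p) \<in> parcs (opt_orientation k)"
      using orientation_of_opt_orientation[of k] by (auto simp: orientation_of_def)
    then show "e \<in> parcs (opt_orientation k)"
      using * e anti pq by auto
  qed
  with * have "A = parcs (opt_orientation k)" by simp
  moreover have "pverts D = pverts (opt_orientation k)"
    by (simp add: pverts_D opt_orientation_def)
  ultimately show "D = opt_orientation k" by simp
qed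

lemma wiener_index_opt: "wiener_index (with_proj (opt_orientation k)) = opt_value k"
  using wiener_index_opt_ge[of k] straight_le(1)[OF straight_opt_orientation] k_large
  by (intro antisym) auto

lemma forward_le:
  assumes "forward_orientation k D"
  shows "wiener_index (with_proj D) \<le> opt_value k"
    and "wiener_index (with_proj D) = opt_value k \<Longrightarrow> D = opt_orientation k"
proof -
  interpret forward_orientation k D by fact
  consider "straight_orientation k D" | l where "1 \<le> l" "l < k" "(Vw l, Vw (Suc l)) \<notin> A"
    by (metis straight_orientation.intro straight_orientation_axioms.intro tree_orientation_axioms)
  then have "wiener_index (with_proj D) \<le> opt_value k \<and>
    (wiener_index (with_proj D) = opt_value k \<longrightarrow> D = opt_orientation k)"
  proof cases
    case 1
    then show ?thesis using straight_le by blast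
  next
    case 2
    then show ?thesis using broken_less[OF assms] by fastforce
  qed
  then show "wiener_index (with_proj D) \<le> opt_value k"
    and "wiener_index (with_proj D) = opt_value k \<Longrightarrow> D = opt_orientation k" by auto
qed

end

section \<open>Symmetry under the converse\<close>

lemma converse_converse_digraph [simp]: "converse_digraph (converse_digraph D) = D"
  by (simp add: converse_digraph_def)

lemma tree_orientation_converse:
  assumes "tree_orientation k D"
  shows "tree_orientation k (converse_digraph D)"
proof -
  interpret tree_orientation k D by fact
  show ?thesis
    using orientation_of_converse_digraph[OF orientation symE] k_ge by unfold_locales
qed

text \<open>Reversal swaps the arguments of \<open>directed_dist\<close>, since \<open>tdist\<close>
  is symmetric, and the double sum is invariant under this swap.\<close>

lemma wiener_index_converse:
  assumes "tree_orientation k D"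
  shows "wiener_index (with_proj (converse_digraph D)) = wiener_index (with_proj D)"
proof -
  interpret tree_orientation k D by fact
  interpret c: tree_orientation k "converse_digraph D" by (rule tree_orientation_converse[OF assms])
  have "directed_dist (converse_digraph D) p q = directed_dist D q p" for p q
    using td_sym[of p q] by (auto simp: directed_dist_def converse_digraph_def rtrancl_converse)
  then show ?thesis
    unfolding wiener_index_eq_directed_dist c.wiener_index_eq_directed_dist by (subst sum.swap) simp
qed

context large_tree
begin

text \<open>Either \<open>D\<close> or its converse directs the first path edge from
  \<open>Vw 1\<close> to \<open>Vw 2\<close>, and both have the same Wiener index.\<close>

lemma orientation_le:
  assumes "orientation_of D (tree k)"
  shows "wiener_index (with_proj D) \<le> opt_value k"
    and "wiener_index (with_proj D) = opt_value k \<longleftrightarrow>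
      D = opt_orientation k \<or> D = converse_digraph (opt_orientation k)"
proof -
  interpret tree_orientation k D using assms k_large by unfold_locales auto
  note c = wiener_index_converse[OF tree_orientation_axioms]
  have "(Vw 1, Vw 2) \<in> tree_edges k" using k_large by (auto simp: tree_edges_def)
  then have "(Vw 1, Vw 2) \<in> A \<or> (Vw 1, Vw 2) \<in> parcs (converse_digraph D)"
    using arc_iff by (auto simp: converse_digraph_def)
  then consider "forward_orientation k D" | "forward_orientation k (converse_digraph D)"
    using tree_orientation_axioms tree_orientation_converse[OF tree_orientation_axioms]
    unfolding forward_orientation_def forward_orientation_axioms_def by blast
  then have *: "wiener_index (with_proj D) \<le> opt_value k \<and> (wiener_index (with_proj D) = opt_value k \<longrightarrow>
      D = opt_orientation k \<or> D = converse_digraph (opt_orientation k))"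
  proof cases
    case 1
    then show ?thesis using forward_le by blast
  next
    case 2
    then show ?thesis using forward_le[OF 2] unfolding c by (metis converse_converse_digraph)
  qed
  interpret opt: straight_orientation k "opt_orientation k"
    using straight_opt_orientation k_large by simp
  show "wiener_index (with_proj D) \<le> opt_value k" using * by blast
  show "wiener_index (with_proj D) = opt_value k \<longleftrightarrow>
      D = opt_orientation k \<or> D = converse_digraph (opt_orientation k)"
    using * wiener_index_opt wiener_index_converse[OF opt.tree_orientation_axioms] by auto
qed

section \<open>Direction changes and the lack of a central vertex\<close>

lemma opt_two_changes:
  assumes "D = opt_orientation k \<or> D = converse_digraph (opt_orientation k)"
  shows "\<exists>u p v. pre_digraph.apath (with_proj (tree k)) u p v \<and> direction_changes D p \<ge> 2"
proof -
  \<comment> \<open>In the optimum these steps go along, against and along the arcs; in its converse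
    all three are flipped. Either way both inner vertices are changes.\<close>
  let ?p = "[(Vy, Vw 3), (Vw 3, Vw 2), (Vw 2, Vx 1)]"
  have "pre_digraph.apath (with_proj (tree k)) Vy ?p (Vx 1)"
    using k_large
    by (auto simp: pre_digraph.apath_def pre_digraph.awalk_def cas_with_proj_eq
        awalk_verts_with_proj_eq tree_def tree_verts_def tree_edges_def)
  moreover have "{i. Suc i < length ?p \<and> (?p ! i \<in> parcs D) \<noteq> (?p ! Suc i \<in> parcs D)} = {0, 1}"
    using assms k_large
    by (auto simp: opt_orientation_def converse_digraph_def less_Suc_eq)
  then have "direction_changes D ?p = 2"
    unfolding direction_changes_def by simp
  ultimately show ?thesis by fastforce
qed

text \<open>No vertex is comparable to both \<open>Vy\<close> and \<open>Vx 1\<close>: the former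
  requires position at least 3, the latter position at most 2.\<close>

lemma opt_no_central_vertex:
  fixes v :: vertex
  assumes "v \<in> tree_verts k"
  shows "\<exists>u \<in> tree_verts k.
    (u, v) \<notin> (parcs (opt_orientation k))\<^sup>* \<and> (v, u) \<notin> (parcs (opt_orientation k))\<^sup>*"
proof -
  interpret straight_orientation k "opt_orientation k"
    using straight_opt_orientation k_large by simp
  have y: "v = Vy" if "(v, Vy) \<in> A\<^sup>*"
    using reach_to_y[OF that] by (auto simp: opt_orientation_def)
  have x: "v \<in> range Vx" if "(Vx 1, v) \<in> A\<^sup>*"
    using reach_from_x[OF that] by (auto simp: opt_orientation_def)
  have "pos v \<le> 2" if "(v, Vx 1) \<in> A\<^sup>*"
    using reach_pos_mono[OF that assms] by (simp add: tree_verts_iff)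
  moreover have "3 \<le> pos v" if "(Vy, v) \<in> A\<^sup>*"
    using reach_pos_mono[OF that _ assms] by (simp add: tree_verts_iff)
  ultimately have "\<not> ((Vy, v) \<in> A\<^sup>* \<or> (v, Vy) \<in> A\<^sup>*) \<or>
      \<not> ((Vx 1, v) \<in> A\<^sup>* \<or> (v, Vx 1) \<in> A\<^sup>*)"
    using y x by fastforce
  moreover have "Vy \<in> tree_verts k" "Vx 1 \<in> tree_verts k" by (simp_all add: tree_verts_iff)
  ultimately show ?thesis by blast
qed

lemma opt_not_comparable:
  assumes "D = opt_orientation k \<or> D = converse_digraph (opt_orientation k)"
  shows "\<not> (\<exists>v \<in> pverts D. \<forall>u \<in> pverts D.
    reachable (with_proj D) u v \<or> reachable (with_proj D) v u)"
proof
  assume "\<exists>v \<in> pverts D. \<forall>u \<in> pverts D. reachable (with_proj D) u v \<or> reachable (with_proj D) v u"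
  moreover have "pverts D = tree_verts k"
    using assms by (auto simp: opt_orientation_def converse_digraph_def)
  moreover have "(u, v) \<in> (parcs D)\<^sup>*" if "reachable (with_proj D) u v" for u v
    using that unfolding reachable_def by (auto dest: rtrancl_on_rtranclI)
  ultimately obtain v where v: "v \<in> tree_verts k"
    "\<And>u. u \<in> tree_verts k \<Longrightarrow> (u, v) \<in> (parcs D)\<^sup>* \<or> (v, u) \<in> (parcs D)\<^sup>*" by metis
  have "(u, v) \<in> (parcs (opt_orientation k))\<^sup>* \<or> (v, u) \<in> (parcs (opt_orientation k))\<^sup>*"
    if "u \<in> tree_verts k" for u
    using assms v(2)[OF that] by (auto simp: converse_digraph_def rtrancl_converse)
  then show False using opt_no_central_vertex[OF v(1)] by blast
qed

end

theorem theorem2: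
  shows "\<exists>K::nat. \<forall>k\<ge>K. 3 dvd k \<longrightarrow>
    (\<forall>D. orientation_of D (tree k) \<longrightarrow>
       wiener_index (with_proj D) \<le> wiener_index (with_proj (opt_orientation k)) \<and>
       (wiener_index (with_proj D) = wiener_index (with_proj (opt_orientation k)) \<longleftrightarrow>
          D = opt_orientation k \<or> D = converse_digraph (opt_orientation k))) \<and>
    (\<forall>D. max_wiener_orientation D (tree k) \<longrightarrow>
       (\<exists>u p v. pre_digraph.apath (with_proj (tree k)) u p v \<and> direction_changes D p \<ge> 2) \<and>
       \<not> (\<exists>v \<in> pverts D. \<forall>u \<in> pverts D.
             reachable (with_proj D) u v \<or> reachable (with_proj D) v u))"
proof (intro exI[of _ 1000] allI impI conjI)
  fix k :: nat and D :: "vertex pair_pre_digraph"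
  assume "1000 \<le> k" "3 dvd k"
  then interpret large_tree k by unfold_locales
  {
    assume D: "orientation_of D (tree k)"
    show "wiener_index (with_proj D) \<le> wiener_index (with_proj (opt_orientation k))"
      using orientation_le(1)[OF D] by (simp only: wiener_index_opt)
    show "wiener_index (with_proj D) = wiener_index (with_proj (opt_orientation k)) \<longleftrightarrow>
        D = opt_orientation k \<or> D = converse_digraph (opt_orientation k)"
      using orientation_le(2)[OF D] by (simp only: wiener_index_opt)
  }
  assume "max_wiener_orientation D (tree k)"
  \<comment> \<open>The optimal orientation is a competitor of \<open>D\<close>, so a maximal
    \<open>D\<close> attains \<open>opt_value k\<close> and the equality case applies.\<close>
  then have "orientation_of D (tree k)" "opt_value k \<le> wiener_index (with_proj D)"
    using orientation_of_opt_orientation[of k]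
    unfolding max_wiener_orientation_def wiener_index_opt[symmetric] by auto
  then have *: "D = opt_orientation k \<or> D = converse_digraph (opt_orientation k)"
    using orientation_le by (metis antisym)
  show "\<exists>u p v. pre_digraph.apath (with_proj (tree k)) u p v \<and> direction_changes D p \<ge> 2"
    by (rule opt_two_changes[OF *])
  show "\<not> (\<exists>v \<in> pverts D. \<forall>u \<in> pverts D.
      reachable (with_proj D) u v \<or> reachable (with_proj D) v u)"
    by (rule opt_not_comparable[OF *])
qed

end
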